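(* Let $a<b$, let $f:[a,b]\to\mathbb{R}$ be a convex function, let $n\ge1$, let $I_n: a=x_0<x_1<\dots<x_{n-1}<x_n=b$ be a division of $[a,b]$, and let $\boldsymbol{\xi}=(\xi_0,\dots,\xi_{n-1})$ with $\xi_i\in[x_i,x_{i+1}]$ for $i=0,\dots,n-1$. Then $$\int_a^b f(t)\,dt=G_n(f;I_n,\boldsymbol{\xi})-S_n(f;I_n,\boldsymbol{\xi}),$$ where $G_n(f;I_n,\boldsymbol{\xi})$ is the generalised trapezoid rule $$G_n(f;I_n,\boldsymbol{\xi}):=\sum_{i=0}^{n-1}\left[(\xi_i-x_i)f(x_i)+(x_{i+1}-\xi_i)f(x_{i+1})\right]$$ and the remainder $S_n(f;I_n,\boldsymbol{\xi})$ satisfies $$\frac12\left[\sum_{i=0}^{n-1}(x_{i+1}-\xi_i)^2f'_+(\xi_i)-\sum_{i=0}^{n-1}(\xi_i-x_i)^2f'_-(\xi_i)\right]\le S_n(f;I_n,\boldsymbol{\xi})$$ $$\le\frac12\left[(b-\xi_{n-1})^2f'_-(b)+\sum_{i=1}^{n-1}\left[(x_i-\xi_{i-1})^2f'_-(x_i)-(\xi_i-x_i)^2f'_+(x_i)\right]-(\xi_0-a)^2f'_+(a)\right].$$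
   Context: $f'_+$ and $f'_-$ denote right and left derivatives of $f$. At the endpoints $a$ and $b$ the derivatives $f'_+(a)\in[-\infty,\infty)$ and $f'_-(b)\in(-\infty,+\infty]$ may be infinite, and the inequalities are read in the extended reals; any term whose squared coefficient is $0$ (including the terms formally involving $f'_-(a)$ when $\xi_0=a$ or $f'_+(b)$ when $\xi_{n-1}=b$) is understood to be $0$. Empty sums are $0$. *)

theory Defs
  imports "HOL-Analysis.Analysis"
begin

(* One-sided derivatives with values in the extended reals. For f convex on {a..b} the limits exist
   for right_deriv at points of {a..<b} and for left_deriv at points of {a<..b}; the values at the
   endpoints may be infinite. At x = b (respectively x = a) the value of right_deriv (left_deriv)
   depends on f outside {a..b}; since 0 * y = 0 for every extended real y, such a value is
   irrelevant in a term with coefficient 0. *)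
definition right_deriv :: "(real \<Rightarrow> real) \<Rightarrow> real \<Rightarrow> ereal" where
  "right_deriv f x = Lim (at_right x) (\<lambda>y. ereal ((f y - f x) / (y - x)))"

definition left_deriv :: "(real \<Rightarrow> real) \<Rightarrow> real \<Rightarrow> ereal" where
  "left_deriv f x = Lim (at_left x) (\<lambda>y. ereal ((f y - f x) / (y - x)))"

definition is_division :: "real \<Rightarrow> real \<Rightarrow> nat \<Rightarrow> (nat \<Rightarrow> real) \<Rightarrow> bool" where
  "is_division a b n x \<longleftrightarrow> x 0 = a \<and> x n = b \<and> (\<forall>i<n. x i < x (Suc i))"

definition gen_trapezoid ::
    "(real \<Rightarrow> real) \<Rightarrow> nat \<Rightarrow> (nat \<Rightarrow> real) \<Rightarrow> (nat \<Rightarrow> real) \<Rightarrow> real" where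
  "gen_trapezoid f n x \<xi> =
     (\<Sum>i<n. (\<xi> i - x i) * f (x i) + (x (Suc i) - \<xi> i) * f (x (Suc i)))"

definition trapezoid_remainder ::
    "(real \<Rightarrow> real) \<Rightarrow> nat \<Rightarrow> (nat \<Rightarrow> real) \<Rightarrow> (nat \<Rightarrow> real) \<Rightarrow> real" where
  "trapezoid_remainder f n x \<xi> = gen_trapezoid f n x \<xi> - integral {x 0..x n} f"

end

theory Submission
  imports Defs
begin

text \<open>
  For a convex function all chord slopes over \<open>{u..v}\<close> lie between the right derivative at \<open>u\<close> and
  the left derivative at \<open>v\<close>. Integrating the resulting affine bounds through \<open>(u, f u)\<close> and
  \<open>(v, f v)\<close> over each of the intervals \<open>{x i..\<xi> i}\<close> and \<open>{\<xi> i..x (Suc i)}\<close> and adding up gives both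
  inequalities.
\<close>

section \<open>One-sided limits of monotone functions\<close>

text \<open>With values in \<open>ereal\<close> the infimum exists even when it is infinite. It
  includes the end \<open>v\<close>, so that later a chord ending at \<open>v\<close> itself can be
  compared with the limit.\<close>

lemma tendsto_at_right_mono:
  fixes g :: "real \<Rightarrow> ereal"
  assumes "u < v" and mono: "mono_on {u<..v} g"
  shows "(g \<longlongrightarrow> (INF y\<in>{u<..v}. g y)) (at_right u)"
proof (rule order_tendstoI)
  fix c assume c: "c < (INF y\<in>{u<..v}. g y)"
  have "\<forall>\<^sub>F y in at_right u. y \<in> {u<..<v}"
    by (rule eventually_at_rightI[OF _ \<open>u < v\<close>]) simp
  then show "\<forall>\<^sub>F y in at_right u. c < g y"
    by eventually_elim (auto intro!: less_le_trans[OF c] INF_lower)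
next
  fix c assume "(INF y\<in>{u<..v}. g y) < c"
  then obtain z where z: "z \<in> {u<..v}" "g z < c"
    by (auto simp: INF_less_iff)
  show "\<forall>\<^sub>F y in at_right u. g y < c"
  proof (rule eventually_at_rightI[of u z])
    fix y assume "y \<in> {u<..<z}"
    then have "g y \<le> g z" using z by (intro mono_onD[OF mono]) auto
    then show "g y < c" using z by simp
  qed (use z in simp)
qed

lemma tendsto_at_left_mono:
  fixes g :: "real \<Rightarrow> ereal"
  assumes "u < v" and mono: "mono_on {u..<v} g"
  shows "(g \<longlongrightarrow> (SUP y\<in>{u..<v}. g y)) (at_left v)"
proof (rule order_tendstoI)
  fix c assume c: "(SUP y\<in>{u..<v}. g y) < c"
  have "\<forall>\<^sub>F y in at_left v. y \<in> {u<..<v}"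
    by (rule eventually_at_leftI[OF _ \<open>u < v\<close>]) simp
  then show "\<forall>\<^sub>F y in at_left v. g y < c"
    by eventually_elim (auto intro!: le_less_trans[OF _ c] SUP_upper)
next
  fix c assume "c < (SUP y\<in>{u..<v}. g y)"
  then obtain z where z: "z \<in> {u..<v}" "c < g z"
    by (auto simp: less_SUP_iff)
  show "\<forall>\<^sub>F y in at_left v. c < g y"
  proof (rule eventually_at_leftI[of z v])
    fix y assume "y \<in> {z<..<v}"
    then have "g z \<le> g y" using z by (intro mono_onD[OF mono]) auto
    then show "c < g y" using z by simp
  qed (use z in simp)
qed

section \<open>Chord slopes and one-sided derivatives of a convex function\<close>

text \<open>The chord over \<open>{u..t}\<close> lies in between: first the right end moves from
  \<open>y\<close> to \<open>t\<close>, then the left end from \<open>u\<close> to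
  \<open>s\<close>.\<close>

lemma convex_on_slope_mono:
  fixes f :: "real \<Rightarrow> real"
  assumes f: "convex_on I f" and I: "u \<in> I" "y \<in> I" "s \<in> I" "t \<in> I"
    and "u < y" "s < t" "u \<le> s" "y \<le> t"
  shows "(f y - f u) / (y - u) \<le> (f t - f s) / (t - s)"
proof -
  have flip: "(f p - f q) / (p - q) = (f q - f p) / (q - p)" for p q
    by (metis minus_diff_eq minus_divide_divide)
  have "(f y - f u) / (y - u) \<le> (f t - f u) / (t - u)"
    using convex_on_slope_le(1)[OF f I(1) I(4), of y] assms by (cases "y = t") (auto simp: flip)
  also have "\<dots> \<le> (f t - f s) / (t - s)"
    using convex_on_slope_le(2)[OF f I(1) I(4), of s] assms by (cases "u = s") (auto simp: flip)
  finally show ?thesis .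
qed

text \<open>Slopes from \<open>u\<close> increase with the other end, so the derivative is their
  infimum, hence at most the slope over \<open>{u..t}\<close>, which is at most that over
  \<open>{s..t}\<close>.\<close>

lemma right_deriv_le_slope:
  assumes f: "convex_on {u..v} f" and st: "u \<le> s" "s < t" "t \<le> v"
  shows "right_deriv f u \<le> ereal ((f t - f s) / (t - s))"
proof -
  let ?g = "\<lambda>y. ereal ((f y - f u) / (y - u))"
  have "mono_on {u<..v} ?g"
    using st by (intro mono_onI) (auto intro!: convex_on_slope_mono[OF f])
  then have "(?g \<longlongrightarrow> (INF y\<in>{u<..v}. ?g y)) (at_right u)"
    using st by (intro tendsto_at_right_mono) auto
  then have "right_deriv f u = (INF y\<in>{u<..v}. ?g y)"
    unfolding right_deriv_def by (intro tendsto_Lim) auto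
  also have "\<dots> \<le> ?g t"
    using st by (intro INF_lower) auto
  also have "\<dots> \<le> ereal ((f t - f s) / (t - s))"
    using st by (auto intro!: convex_on_slope_mono[OF f])
  finally show ?thesis .
qed

lemma slope_le_left_deriv:
  assumes f: "convex_on {u..v} f" and st: "u \<le> s" "s < t" "t \<le> v"
  shows "ereal ((f t - f s) / (t - s)) \<le> left_deriv f v"
proof -
  let ?g = "\<lambda>y. ereal ((f y - f v) / (y - v))"
  \<comment> \<open>For \<open>y < v\<close> the quotients in \<open>left_deriv\<close> have a
    negative denominator; this rewrites them as slopes of chords from \<open>y\<close> to
    \<open>v\<close>.\<close>
  have flip: "(f p - f q) / (p - q) = (f q - f p) / (q - p)" for p q
    by (metis minus_diff_eq minus_divide_divide)
  have "mono_on {u..<v} ?g"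
    unfolding flip[of _ v] using st
    by (intro mono_onI) (auto intro!: convex_on_slope_mono[OF f])
  then have lim: "(?g \<longlongrightarrow> (SUP y\<in>{u..<v}. ?g y)) (at_left v)"
    using st by (intro tendsto_at_left_mono) auto
  have "ereal ((f t - f s) / (t - s)) \<le> ?g s"
    unfolding flip[of _ v] using st by (auto intro!: convex_on_slope_mono[OF f])
  also have "\<dots> \<le> (SUP y\<in>{u..<v}. ?g y)"
    using st by (intro SUP_upper) auto
  also have "\<dots> = left_deriv f v"
    unfolding left_deriv_def using lim by (intro tendsto_Lim[symmetric]) auto
  finally show ?thesis .
qed

section \<open>Integrability and affine bounds on one interval\<close>

text \<open>A convex function may jump at \<open>a\<close> and \<open>b\<close>, so continuity is
  used only inside; together with boundedness this gives integrability on the open interval, and the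
  endpoints do not matter.\<close>

lemma convex_on_Icc_integrable:
  fixes f :: "real \<Rightarrow> real"
  assumes f: "convex_on {a..b} f"
  shows "f integrable_on {a..b}"
proof -
  define M where "M = max (f a) (f b)"
  define B where "B = \<bar>M\<bar> + 2 * \<bar>f ((a + b) / 2)\<bar>"
  have upper: "f t \<le> M" if "t \<in> {a..b}" for t
    using convex_on_le_max[OF f that] by (simp add: M_def)
  \<comment> \<open>Convexity at the midpoint of \<open>t\<close> and its reflection turns the upper bound into a lower bound.\<close>
  have lower: "2 * f ((a + b) / 2) - M \<le> f t" if "t \<in> {a..b}" for t
  proof -
    have "f ((a + b) / 2) \<le> f t / 2 + f (a + b - t) / 2"
      using convex_onD[OF f, of "1/2" t "a + b - t"] that by (simp add: field_simps)
    moreover have "f (a + b - t) \<le> M" using that by (intro upper) auto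
    ultimately show ?thesis by simp
  qed
  have bound: "\<bar>f t\<bar> \<le> B" if "t \<in> {a..b}" for t
    using upper[OF that] lower[OF that] unfolding B_def by linarith
  have "continuous_on {a<..<b} f"
    by (intro convex_on_continuous convex_on_subset[OF f]) auto
  then have "f \<in> borel_measurable (lebesgue_on {a<..<b})"
    by (intro continuous_imp_measurable_on_sets_lebesgue) auto
  then have "f integrable_on {a<..<b}"
  proof (rule measurable_bounded_by_integrable_imp_integrable)
    show "(\<lambda>t. B) integrable_on {a<..<b}"
      by (simp add: integrable_on_Icc_iff_Ioo[symmetric] integrable_const_ivl)
  qed (use bound in auto)
  then show ?thesis by (simp add: integrable_on_Icc_iff_Ioo)
qed

lemma has_integral_affine:
  fixes p m w :: real
  assumes "u \<le> v"
  shows "((\<lambda>t. p + m * (t - w)) has_integral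
      p * (v - u) + m * ((v - w)\<^sup>2 - (u - w)\<^sup>2) / 2) {u..v}"
proof -
  have "((\<lambda>t. p + m * (t - w)) has_integral
      (p * v + m * (v - w)\<^sup>2 / 2) - (p * u + m * (u - w)\<^sup>2 / 2)) {u..v}"
    using assms
    by (intro fundamental_theorem_of_calculus)
      (auto intro!: derivative_eq_intros simp flip: has_real_derivative_iff_has_vector_derivative)
  then show ?thesis by (simp add: algebra_simps diff_divide_distrib)
qed

text \<open>If m is the finite right derivative at \<open>u\<close>, then f(t) <= f(v) + m (t - v)
  and f(t) >= f(u) + m (t - u) on the interval. Integrating these gives the first and the second
  bound.\<close>

lemma right_deriv_integral_bounds:
  assumes f: "convex_on {u..v} f" and "u \<le> v"
  shows "ereal ((v - u)\<^sup>2) * right_deriv f u \<le> ereal (2 * ((v - u) * f v - integral {u..v} f))"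
    and "ereal ((v - u)\<^sup>2) * right_deriv f u \<le> ereal (2 * (integral {u..v} f - (v - u) * f u))"
proof -
  have I: "(f has_integral integral {u..v} f) {u..v}"
    using convex_on_Icc_integrable[OF f] by blast
  note aff = has_integral_affine[OF \<open>u \<le> v\<close>]
  have slope: "m * (t - s) \<le> f t - f s"
    if "right_deriv f u = ereal m" "u \<le> s" "s \<le> t" "t \<le> v" for m s t
    using right_deriv_le_slope[OF f, of s t] that by (cases "s = t") (auto simp: le_divide_eq)
  have "m * (v - u)\<^sup>2 \<le> 2 * ((v - u) * f v - integral {u..v} f)"
    if m: "right_deriv f u = ereal m" for m
    using has_integral_le[OF I aff[of "f v" m v]] slope[OF m, of _ v]
    by (force simp: algebra_simps power2_commute[of u v])
  moreover have "m * (v - u)\<^sup>2 \<le> 2 * (integral {u..v} f - (v - u) * f u)"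
    if m: "right_deriv f u = ereal m" for m
    using has_integral_le[OF aff[of "f u" m u] I] slope[OF m, of u]
    by (force simp: algebra_simps)
  \<comment> \<open>The non-finite cases: for \<open>u < v\<close> a derivative -\<infinity> makes
    the left side -\<infinity>, and +\<infinity> is excluded by the chord over
    \<open>{u..v}\<close>. For \<open>u = v\<close> both sides are 0.\<close>
  moreover have "right_deriv f u \<noteq> \<infinity>" if "u < v"
    using right_deriv_le_slope[OF f, of u v] that by auto
  ultimately show "ereal ((v - u)\<^sup>2) * right_deriv f u
        \<le> ereal (2 * ((v - u) * f v - integral {u..v} f))"
    and "ereal ((v - u)\<^sup>2) * right_deriv f u
        \<le> ereal (2 * (integral {u..v} f - (v - u) * f u))"
    using \<open>u \<le> v\<close> by (cases "u = v"; cases "right_deriv f u"; simp add: mult.commute)+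
qed

text \<open>Now the derivative bounds all slopes from above, so both affine bounds reverse;
  +\<infinity> is the trivial value and -\<infinity> the excluded one.\<close>

lemma left_deriv_integral_bounds:
  assumes f: "convex_on {u..v} f" and "u \<le> v"
  shows "ereal (2 * ((v - u) * f v - integral {u..v} f)) \<le> ereal ((v - u)\<^sup>2) * left_deriv f v"
    and "ereal (2 * (integral {u..v} f - (v - u) * f u)) \<le> ereal ((v - u)\<^sup>2) * left_deriv f v"
proof -
  have I: "(f has_integral integral {u..v} f) {u..v}"
    using convex_on_Icc_integrable[OF f] by blast
  note aff = has_integral_affine[OF \<open>u \<le> v\<close>]
  have slope: "f t - f s \<le> m * (t - s)"
    if "left_deriv f v = ereal m" "u \<le> s" "s \<le> t" "t \<le> v" for m s t
    using slope_le_left_deriv[OF f, of s t] that by (cases "s = t") (auto simp: divide_le_eq)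
  have "2 * ((v - u) * f v - integral {u..v} f) \<le> m * (v - u)\<^sup>2"
    if m: "left_deriv f v = ereal m" for m
    using has_integral_le[OF aff[of "f v" m v] I] slope[OF m, of _ v]
    by (force simp: algebra_simps power2_commute[of u v])
  moreover have "2 * (integral {u..v} f - (v - u) * f u) \<le> m * (v - u)\<^sup>2"
    if m: "left_deriv f v = ereal m" for m
    using has_integral_le[OF I aff[of "f u" m u]] slope[OF m, of u]
    by (force simp: algebra_simps)
  moreover have "left_deriv f v \<noteq> -\<infinity>" if "u < v"
    using slope_le_left_deriv[OF f, of u v] that by auto
  ultimately show "ereal (2 * ((v - u) * f v - integral {u..v} f))
        \<le> ereal ((v - u)\<^sup>2) * left_deriv f v"
    and "ereal (2 * (integral {u..v} f - (v - u) * f u))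
        \<le> ereal ((v - u)\<^sup>2) * left_deriv f v"
    using \<open>u \<le> v\<close> by (cases "u = v"; cases "left_deriv f v"; simp add: mult.commute)+
qed

section \<open>Summation over a division\<close>

lemma is_division_mono:
  assumes "is_division a b n x" "i \<le> j" "j \<le> n"
  shows "x i \<le> x j"
  using assms(2,3)
proof (induction j rule: dec_induct)
  case (step j)
  then have "x j < x (Suc j)" using assms(1) by (simp add: is_division_def)
  then show ?case using step by simp
qed simp

lemma integral_division:
  fixes f :: "real \<Rightarrow> real"
  assumes "f integrable_on {a..b}" "is_division a b n x"
  shows "integral {a..b} f = (\<Sum>i<n. integral {x i..x (Suc i)} f)"
proof -
  have "k \<le> n \<Longrightarrow> integral {x 0..x k} f = (\<Sum>i<k. integral {x i..x (Suc i)} f)" for k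
  proof (induction k)
    case (Suc k)
    have le: "x 0 \<le> x k" "x k \<le> x (Suc k)" "x (Suc k) \<le> x n"
      using Suc.prems by (auto intro!: is_division_mono[OF assms(2)])
    have "f integrable_on {x 0..x (Suc k)}"
      using assms le by (auto simp: is_division_def intro: integrable_on_subinterval)
    then show ?case
      using Suc le Henstock_Kurzweil_Integration.integral_combine[of "x 0" "x k" "x (Suc k)" f]
      by simp
  qed simp
  then show ?thesis using assms(2) by (auto simp: is_division_def)
qed

theorem theorem7:
  fixes a b :: real and f :: "real \<Rightarrow> real" and n :: nat and x \<xi> :: "nat \<Rightarrow> real"
  assumes "a < b"
    and "convex_on {a..b} f"
    and "n \<ge> 1"
    and "is_division a b n x"
    and "\<forall>i<n. \<xi> i \<in> {x i..x (Suc i)}"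
  shows "(f has_integral (gen_trapezoid f n x \<xi> - trapezoid_remainder f n x \<xi>)) {a..b}
    \<and> ereal (1/2) *
        ((\<Sum>i<n. ereal ((x (Suc i) - \<xi> i)\<^sup>2) * right_deriv f (\<xi> i))
         - (\<Sum>i<n. ereal ((\<xi> i - x i)\<^sup>2) * left_deriv f (\<xi> i)))
      \<le> ereal (trapezoid_remainder f n x \<xi>)
    \<and> ereal (trapezoid_remainder f n x \<xi>)
      \<le> ereal (1/2) *
        (ereal ((b - \<xi> (n - 1))\<^sup>2) * left_deriv f b
         + (\<Sum>i\<in>{1..<n}. ereal ((x i - \<xi> (i - 1))\<^sup>2) * left_deriv f (x i)
                        - ereal ((\<xi> i - x i)\<^sup>2) * right_deriv f (x i))
         - ereal ((\<xi> 0 - a)\<^sup>2) * right_deriv f a)"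
proof -
  \<comment> \<open>\<open>L i\<close> and \<open>R i\<close> are the errors of the rectangle rules
    on the two pieces cut off by \<open>\<xi> i\<close>, with heights taken at the division points;
    together they make up the remainder.\<close>
  define L where "L i = (\<xi> i - x i) * f (x i) - integral {x i..\<xi> i} f" for i
  define R where "R i = (x (Suc i) - \<xi> i) * f (x (Suc i)) - integral {\<xi> i..x (Suc i)} f" for i
  have x0: "x 0 = a" and xn: "x n = b"
    using assms(4) by (auto simp: is_division_def)
  have \<xi>: "x i \<le> \<xi> i" "\<xi> i \<le> x (Suc i)" if "i < n" for i
    using assms(5) that by auto
  have x: "a \<le> x i" "x i \<le> b" if "i \<le> n" for i
    using is_division_mono[OF assms(4), of 0 i] is_division_mono[OF assms(4), of i n] that x0 xn
    by auto
  have int: "f integrable_on {a..b}"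
    by (rule convex_on_Icc_integrable[OF assms(2)])
  have cL: "convex_on {x i..\<xi> i} f" and cR: "convex_on {\<xi> i..x (Suc i)} f" if "i < n" for i
    using \<xi>[OF that] x[of i] x[of "Suc i"] that by (auto intro!: convex_on_subset[OF assms(2)])
  have split: "integral {x i..x (Suc i)} f = integral {x i..\<xi> i} f + integral {\<xi> i..x (Suc i)} f"
    if "i < n" for i
  proof -
    have "f integrable_on {x i..x (Suc i)}"
      using x[of i] x[of "Suc i"] that by (intro integrable_on_subinterval[OF int]) auto
    then show ?thesis
      using \<xi>[OF that] Henstock_Kurzweil_Integration.integral_combine[of "x i" "\<xi> i" "x (Suc i)" f]
      by simp
  qed
  have rem: "trapezoid_remainder f n x \<xi> = (\<Sum>i<n. R i + L i)"
    unfolding trapezoid_remainder_def gen_trapezoid_def x0 xn integral_division[OF int assms(4)]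
      sum_subtractf[symmetric]
    by (intro sum.cong) (auto simp: split R_def L_def)

  have R1: "ereal ((x (Suc i) - \<xi> i)\<^sup>2) * right_deriv f (\<xi> i) \<le> ereal (2 * R i)"
    and R2: "ereal (2 * R i) \<le> ereal ((x (Suc i) - \<xi> i)\<^sup>2) * left_deriv f (x (Suc i))"
    if "i < n" for i
    unfolding R_def using \<xi>(2)[OF that] cR[OF that]
    by (intro right_deriv_integral_bounds left_deriv_integral_bounds; simp)+
  \<comment> \<open>On the left piece the height is taken at the left end, so the second bounds
    apply, and they control the integral minus the rectangle, which is \<open>- L i\<close>. This is
    the source of the minus signs in the theorem.\<close>
  have L1: "ereal (- 2 * L i) \<le> ereal ((\<xi> i - x i)\<^sup>2) * left_deriv f (\<xi> i)"
    and L2: "ereal ((\<xi> i - x i)\<^sup>2) * right_deriv f (x i) \<le> ereal (- 2 * L i)"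
    if "i < n" for i
    using left_deriv_integral_bounds(2)[OF cL[OF that] \<xi>(1)[OF that]]
      right_deriv_integral_bounds(2)[OF cL[OF that] \<xi>(1)[OF that]]
    by (simp_all add: L_def algebra_simps)

  \<comment> \<open>Lets the factor 1/2 be handled by monotonicity of multiplication, without
    distributing it over \<open>ereal\<close> sums.\<close>
  have half: "ereal r = ereal (1/2) * ereal (2 * r)" for r
    by simp
  have lower: "(\<Sum>i<n. ereal ((x (Suc i) - \<xi> i)\<^sup>2) * right_deriv f (\<xi> i))
      - (\<Sum>i<n. ereal ((\<xi> i - x i)\<^sup>2) * left_deriv f (\<xi> i))
      \<le> ereal (2 * trapezoid_remainder f n x \<xi>)"
  proof -
    have "(\<Sum>i<n. ereal ((x (Suc i) - \<xi> i)\<^sup>2) * right_deriv f (\<xi> i))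
        - (\<Sum>i<n. ereal ((\<xi> i - x i)\<^sup>2) * left_deriv f (\<xi> i))
        \<le> (\<Sum>i<n. ereal (2 * R i)) - (\<Sum>i<n. ereal (- 2 * L i))"
      \<comment> \<open>The first sum is bounded above and the second below by real numbers, so
        their difference is never \<infinity> - \<infinity>.\<close>
      by (intro ereal_minus_mono sum_mono R1 L1) auto
    also have "\<dots> = ereal (2 * trapezoid_remainder f n x \<xi>)"
      by (simp add: rem sum.distrib sum_negf sum_distrib_left distrib_left)
    finally show ?thesis .
  qed
  have upper: "ereal (2 * trapezoid_remainder f n x \<xi>)
      \<le> ereal ((b - \<xi> (n - 1))\<^sup>2) * left_deriv f b
         + (\<Sum>i\<in>{1..<n}. ereal ((x i - \<xi> (i - 1))\<^sup>2) * left_deriv f (x i)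
                        - ereal ((\<xi> i - x i)\<^sup>2) * right_deriv f (x i))
         - ereal ((\<xi> 0 - a)\<^sup>2) * right_deriv f a"
  proof -
    obtain k where n: "n = Suc k"
      using assms(3) by (cases n) auto
    \<comment> \<open>Regrouping by division points: an inner point \<open>x i\<close> receives
      \<open>R (i - 1)\<close> from its left and \<open>L i\<close> from its right, while
      \<open>R (n - 1)\<close> belongs to \<open>b\<close> and \<open>L 0\<close> to
      \<open>a\<close>.\<close>
    have "(\<Sum>i<n. R i) = R (n - 1) + (\<Sum>i\<in>{1..<n}. R (i - 1))"
      unfolding n One_nat_def sum.shift_bounds_Suc_ivl by (simp add: atLeast0LessThan)
    moreover have "(\<Sum>i<n. L i) = L 0 + (\<Sum>i\<in>{1..<n}. L i)"
      using assms(3) by (simp add: lessThan_atLeast0 sum.atLeast_Suc_lessThan)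
    \<comment> \<open>The double negatives give the expression the same shape as the target, so that
      \<open>R2\<close> and \<open>L2\<close> apply term by term.\<close>
    ultimately have "2 * trapezoid_remainder f n x \<xi>
        = 2 * R (n - 1) + (\<Sum>i\<in>{1..<n}. 2 * R (i - 1) - (- 2 * L i)) - (- 2 * L 0)"
      by (simp add: rem sum.distrib sum_distrib_left distrib_left)
    then have "ereal (2 * trapezoid_remainder f n x \<xi>)
        = ereal (2 * R (n - 1)) + (\<Sum>i\<in>{1..<n}. ereal (2 * R (i - 1)) - ereal (- 2 * L i))
          - ereal (- 2 * L 0)"
      by simp
    also have "\<dots> \<le> ereal ((b - \<xi> (n - 1))\<^sup>2) * left_deriv f b
         + (\<Sum>i\<in>{1..<n}. ereal ((x i - \<xi> (i - 1))\<^sup>2) * left_deriv f (x i)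
                        - ereal ((\<xi> i - x i)\<^sup>2) * right_deriv f (x i))
         - ereal ((\<xi> 0 - a)\<^sup>2) * right_deriv f a"
    proof (intro ereal_minus_mono add_mono sum_mono)
      show "ereal (2 * R (n - 1)) \<le> ereal ((b - \<xi> (n - 1))\<^sup>2) * left_deriv f b"
        using R2[of "n - 1"] xn by (simp add: n)
      show "ereal (2 * R (i - 1)) \<le> ereal ((x i - \<xi> (i - 1))\<^sup>2) * left_deriv f (x i)"
        if "i \<in> {1..<n}" for i
        using R2[of "i - 1"] that by auto
      show "ereal ((\<xi> i - x i)\<^sup>2) * right_deriv f (x i) \<le> ereal (- 2 * L i)"
        if "i \<in> {1..<n}" for i
        using L2[of i] that by auto
      show "ereal ((\<xi> 0 - a)\<^sup>2) * right_deriv f a \<le> ereal (- 2 * L 0)"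
        using L2[of 0] x0 assms(3) by simp
    qed
    finally show ?thesis .
  qed
  show ?thesis
  proof (intro conjI)
    show "(f has_integral (gen_trapezoid f n x \<xi> - trapezoid_remainder f n x \<xi>)) {a..b}"
      using int by (simp add: trapezoid_remainder_def x0 xn integrable_integral)
  qed (unfold half[of "trapezoid_remainder f n x \<xi>"],
       intro ereal_mult_left_mono lower upper; simp)+
qed

end
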